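(* Let $F=\pi_0F_0+(1-\pi_0)G$ with $0<\pi_0\le1$ be the two-component mixture distribution of $Z$ (see context), with densities $f$ of $F$ and $f_0$ of $F_0$. Then for every $z$ with $0<F_0(z)<1$, the local false discovery rate $\mathrm{fdr}(z):=\Pr(\text{null}\mid Z=z)$ can be represented through the comparison density as $$\mathrm{fdr}(z)=\frac{\pi_0}{d\big(F_0(z);F_0,F\big)} .$$
   Context: Model: a case is null with probability $\pi_0$ and non-null with probability $1-\pi_0$; given null, $Z$ has distribution function $F_0$ with density $f_0$; given non-null, $Z$ has distribution function $G$ with density $g$. Thus $Z$ has distribution function $F=\pi_0F_0+(1-\pi_0)G$ and density $f=\pi_0f_0+(1-\pi_0)g$. Assume $f_0>0$ on $\{z:0<F_0(z)<1\}$, so that $F_0$ is invertible there with inverse the quantile function $F_0^{-1}$. The conditional probability $\Pr(\text{null}\mid Z=z)$ is the version given by Bayes' rule from these densities. For continuous distributions $P$ and $Q$ with densities $p$ and $q$, the comparison density is $d(u;P,Q)=\dfrac{q(P^{-1}(u))}{p(P^{-1}(u))}$, $0<u<1$; it is the derivative of the comparison distribution function $D(u;P,Q)=Q(P^{-1}(u))$. *)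

theory Defs
  imports "HOL-Probability.Probability"
begin

definition has_density :: "(real \<Rightarrow> real) \<Rightarrow> (real \<Rightarrow> real) \<Rightarrow> bool" where
  "has_density P p \<longleftrightarrow>
     p \<in> borel_measurable borel \<and> (\<forall>x. 0 \<le> p x) \<and>
     prob_space (density lborel (\<lambda>x. ennreal (p x))) \<and>
     P = cdf (density lborel (\<lambda>x. ennreal (p x)))"

definition quantile :: "(real \<Rightarrow> real) \<Rightarrow> real \<Rightarrow> real" where
  "quantile P u = Inf {x. u \<le> P x}"

text \<open>
  The comparison density d(u; P, Q), where P has density p and Q has density q.
  Q enters only through the chosen version q of its density.
\<close>
definition comparison_density ::
    "(real \<Rightarrow> real) \<Rightarrow> (real \<Rightarrow> real) \<Rightarrow> (real \<Rightarrow> real) \<Rightarrow> real \<Rightarrow> real" where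
  "comparison_density P p q u = q (quantile P u) / p (quantile P u)"

text \<open>
  N is the event of being null. The two conditional laws of Z are required only when the
  conditioning event has positive probability; in particular, if every case is null
  almost surely, G is an arbitrary distribution with a density.
\<close>
locale two_groups_model = prob_space M
  for M :: "'a measure" and N :: "'a set" and Z :: "'a \<Rightarrow> real" and \<pi>\<^sub>0 :: real
    and F\<^sub>0 f\<^sub>0 G g :: "real \<Rightarrow> real" +
  assumes null_event: "N \<in> events"
    and prob_null: "prob N = \<pi>\<^sub>0"
    and measurable_Z: "random_variable borel Z"
    and density_null: "has_density F\<^sub>0 f\<^sub>0"
    and density_nonnull: "has_density G g"
    and null_law: "0 < \<pi>\<^sub>0 \<Longrightarrow> distributed (uniform_measure M N) lborel Z f\<^sub>0"
    and nonnull_law: "\<pi>\<^sub>0 < 1 \<Longrightarrow> distributed (uniform_measure M (space M - N)) lborel Z g"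

text \<open>
  The version of the conditional probability of N given \<open>Z = z\<close> supplied by Bayes' rule, where
  p and q are the densities of Z given N and given the complement of N.
\<close>
definition bayes_posterior ::
    "'a measure \<Rightarrow> 'a set \<Rightarrow> (real \<Rightarrow> real) \<Rightarrow> (real \<Rightarrow> real) \<Rightarrow> real \<Rightarrow> real" where
  "bayes_posterior M N p q z =
     measure M N * p z / (measure M N * p z + measure M (space M - N) * q z)"

definition local_fdr ::
    "'a measure \<Rightarrow> 'a set \<Rightarrow> (real \<Rightarrow> real) \<Rightarrow> (real \<Rightarrow> real) \<Rightarrow> real \<Rightarrow> real" where
  "local_fdr M N f\<^sub>0 g z = bayes_posterior M N f\<^sub>0 g z"

context two_groups_model
begin

lemma measurable_f0[measurable]: "f\<^sub>0 \<in> borel_measurable borel"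
  and measurable_g[measurable]: "g \<in> borel_measurable borel"
  and f0_nonneg: "0 \<le> f\<^sub>0 x" and g_nonneg: "0 \<le> g x"
  using density_null density_nonnull by (auto simp: has_density_def)

lemma pi0_bounds: "0 \<le> \<pi>\<^sub>0" "\<pi>\<^sub>0 \<le> 1"
  using prob_null by auto

lemma prob_nonnull: "prob (space M - N) = 1 - \<pi>\<^sub>0"
  using prob_compl[OF null_event] prob_null by simp

lemma emeasure_joint:
  assumes E: "E \<in> events" and c: "prob E = c" and B: "B \<in> sets borel"
    and [measurable]: "p \<in> borel_measurable borel" and p: "\<And>x. 0 \<le> p x"
    and law: "0 < c \<Longrightarrow> distributed (uniform_measure M E) lborel Z (\<lambda>x. ennreal (p x))"
  shows "emeasure M (E \<inter> (Z -` B \<inter> space M)) =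
    (\<integral>\<^sup>+x. ennreal (c * p x) * indicator B x \<partial>lborel)"
proof (cases "c = 0")
  case True
  have "emeasure M E = 0" using c True by (simp add: emeasure_eq_measure)
  then have "emeasure M (E \<inter> (Z -` B \<inter> space M)) = 0"
    using emeasure_mono[of "E \<inter> (Z -` B \<inter> space M)" E M] E by (metis inf_le1 le_zero_eq)
  then show ?thesis using True by simp
next
  case False
  then have c0: "0 < c" using c measure_nonneg[of M E] by linarith
  have ZB: "Z -` B \<inter> space M \<in> events"
    using measurable_Z B by (rule measurable_sets)
  have eq: "emeasure M (E \<inter> (Z -` B \<inter> space M)) / ennreal c
      = (\<integral>\<^sup>+x. ennreal (p x) * indicator B x \<partial>lborel)"
    using distributed_emeasure[OF law[OF c0], of B] B E ZB c
    by (simp add: emeasure_eq_measure)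
  have "(\<integral>\<^sup>+x. ennreal (c * p x) * indicator B x \<partial>lborel)
      = ennreal c * (\<integral>\<^sup>+x. ennreal (p x) * indicator B x \<partial>lborel)"
    using c0 p B by (subst nn_integral_cmult[symmetric]) (auto simp: ennreal_mult' mult.assoc)
  also have "\<dots> = emeasure M (E \<inter> (Z -` B \<inter> space M))"
    using c0 unfolding eq[symmetric]
    by (simp add: emeasure_eq_measure divide_ennreal ennreal_mult'[symmetric])
  finally show ?thesis by simp
qed

lemma distributed_mixture:
  "distributed M lborel Z (\<lambda>z. ennreal (\<pi>\<^sub>0 * f\<^sub>0 z + (1 - \<pi>\<^sub>0) * g z))"
  unfolding distributed_def
proof (intro conjI)
  show Z: "Z \<in> measurable M lborel" using measurable_Z by simp
  show "distr M lborel Z = density lborel (\<lambda>z. ennreal (\<pi>\<^sub>0 * f\<^sub>0 z + (1 - \<pi>\<^sub>0) * g z))"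
  proof (rule measure_eqI)
    fix B assume "B \<in> sets (distr M lborel Z)"
    then have [measurable]: "B \<in> sets borel" by simp
    let ?A = "Z -` B \<inter> space M"
    have A: "?A \<in> events" using measurable_sets[OF measurable_Z] by simp
    have "emeasure M ?A = emeasure M (N \<inter> ?A) + emeasure M ((space M - N) \<inter> ?A)"
      using A null_event by (subst plus_emeasure) (auto intro!: arg_cong[where f="emeasure M"])
    also have "\<dots> = (\<integral>\<^sup>+x. ennreal (\<pi>\<^sub>0 * f\<^sub>0 x) * indicator B x \<partial>lborel)
        + (\<integral>\<^sup>+x. ennreal ((1 - \<pi>\<^sub>0) * g x) * indicator B x \<partial>lborel)"
      using null_event
      by (intro arg_cong2[where f="(+)"] emeasure_joint)
         (auto simp: prob_null prob_nonnull f0_nonneg g_nonneg null_law nonnull_law)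
    also have "\<dots> = (\<integral>\<^sup>+x. ennreal (\<pi>\<^sub>0 * f\<^sub>0 x + (1 - \<pi>\<^sub>0) * g x) * indicator B x \<partial>lborel)"
      using pi0_bounds
      by (subst nn_integral_add[symmetric])
         (auto intro!: nn_integral_cong simp: f0_nonneg g_nonneg distrib_right)
    finally show "emeasure (distr M lborel Z) B =
        emeasure (density lborel (\<lambda>z. ennreal (\<pi>\<^sub>0 * f\<^sub>0 z + (1 - \<pi>\<^sub>0) * g z))) B"
      using Z by (simp add: emeasure_distr emeasure_density)
  qed simp
qed simp

lemma mixture_has_density:
  "has_density (\<lambda>x. \<pi>\<^sub>0 * F\<^sub>0 x + (1 - \<pi>\<^sub>0) * G x) (\<lambda>x. \<pi>\<^sub>0 * f\<^sub>0 x + (1 - \<pi>\<^sub>0) * g x)"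
proof -
  let ?d = "\<lambda>p. density lborel (\<lambda>x. ennreal (p x))"
  let ?f = "\<lambda>x. \<pi>\<^sub>0 * f\<^sub>0 x + (1 - \<pi>\<^sub>0) * g x"
  have ps: "prob_space (?d f\<^sub>0)" "prob_space (?d g)"
    using density_null density_nonnull by (auto simp: has_density_def)
  have pf: "prob_space (?d ?f)"
    using prob_space_distr[of Z lborel] distributed_mixture
    by (auto simp: distributed_def)
  have nn: "0 \<le> \<pi>\<^sub>0 * f\<^sub>0 z" "0 \<le> (1 - \<pi>\<^sub>0) * g z" for z
    using pi0_bounds f0_nonneg g_nonneg by auto
  have "cdf (?d ?f) x = \<pi>\<^sub>0 * cdf (?d f\<^sub>0) x + (1 - \<pi>\<^sub>0) * cdf (?d g) x" for x
  proof -
    have "emeasure (?d ?f) {..x} = (\<integral>\<^sup>+y. (ennreal \<pi>\<^sub>0 * (ennreal (f\<^sub>0 y) * indicator {..x} y)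
        + ennreal (1 - \<pi>\<^sub>0) * (ennreal (g y) * indicator {..x} y)) \<partial>lborel)"
      using nn pi0_bounds f0_nonneg g_nonneg
      by (auto simp: emeasure_density ennreal_mult[symmetric] ennreal_plus[symmetric] indicator_def
          simp del: ennreal_plus intro!: nn_integral_cong)
    also have "\<dots> = ennreal \<pi>\<^sub>0 * emeasure (?d f\<^sub>0) {..x} + ennreal (1 - \<pi>\<^sub>0) * emeasure (?d g) {..x}"
      by (simp add: nn_integral_add nn_integral_cmult emeasure_density)
    finally show ?thesis
      using pi0_bounds ps pf
      by (simp add: cdf_def finite_measure.emeasure_eq_measure prob_space.finite_measure
          ennreal_mult[symmetric] ennreal_plus[symmetric] del: ennreal_plus)
  qed
  then show ?thesis
    using density_null density_nonnull pf nn by (auto simp: has_density_def)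
qed

text \<open>The Bayes posterior is indeed a version of the conditional probability of N given Z.\<close>
lemma local_fdr_version:
  "AE \<omega> in M. real_cond_exp M (vimage_algebra (space M) Z borel) (indicator N) \<omega>
     = local_fdr M N f\<^sub>0 g (Z \<omega>)"
proof -
  let ?S = "vimage_algebra (space M) Z borel"
  let ?h = "local_fdr M N f\<^sub>0 g"
  let ?f = "\<lambda>z. \<pi>\<^sub>0 * f\<^sub>0 z + (1 - \<pi>\<^sub>0) * g z"
  have h: "?h z = \<pi>\<^sub>0 * f\<^sub>0 z / ?f z" for z
    by (simp add: local_fdr_def bayes_posterior_def prob_null prob_nonnull)
  have nn: "0 \<le> \<pi>\<^sub>0 * f\<^sub>0 z" "0 \<le> (1 - \<pi>\<^sub>0) * g z" for z
    using pi0_bounds f0_nonneg g_nonneg by auto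
  have hb: "0 \<le> ?h z" "?h z \<le> 1" for z
    unfolding h using nn[of z] by (auto simp: divide_le_eq_1 intro!: divide_nonneg_nonneg)
  have fh: "?f z * ?h z = \<pi>\<^sub>0 * f\<^sub>0 z" for z
  proof (cases "?f z = 0")
    case True
    then have "\<pi>\<^sub>0 * f\<^sub>0 z = 0" using nn[of z] by linarith
    with True show ?thesis by (simp only: mult_zero_left)
  next
    case False
    then show ?thesis unfolding h by simp
  qed
  have fe: "ennreal (?f z) * ennreal (?h z) = ennreal (\<pi>\<^sub>0 * f\<^sub>0 z)" for z
    by (metis fh ennreal_mult add_nonneg_nonneg nn hb(1))
  have [measurable]: "?h \<in> borel_measurable borel" unfolding h by measurable
  have [measurable]: "Z \<in> borel_measurable M" by (rule measurable_Z)
  have [measurable]: "N \<in> sets M" by (rule null_event)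
  have sub: "subalgebra M ?S"
    unfolding subalgebra_def
    using measurable_sets[OF measurable_Z] by (auto simp: sets_vimage_algebra2)
  interpret finite_measure_subalgebra M ?S
    by unfold_locales (rule sub)
  have ZS: "Z \<in> measurable ?S borel" by (rule measurable_vimage_algebra1) auto
  show ?thesis
  proof (rule real_cond_exp_charact)
    fix A assume "A \<in> sets ?S"
    then obtain B where [measurable]: "B \<in> sets borel" and A: "A = Z -` B \<inter> space M"
      by (auto simp: sets_vimage_algebra2)
    have [measurable]: "A \<in> sets M" unfolding A by measurable
    have D: "ennreal (\<integral>x\<in>A. ?h (Z x) \<partial>M) = emeasure M (N \<inter> A)"
    proof -
      have "ennreal (\<integral>x\<in>A. ?h (Z x) \<partial>M) = (\<integral>\<^sup>+x. ennreal (indicator A x * ?h (Z x)) \<partial>M)"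
        unfolding set_lebesgue_integral_def real_scaleR_def
        using hb by (intro nn_integral_eq_integral[symmetric] integrable_const_bound[where B=1])
          (auto simp: indicator_def)
      also have "\<dots> = (\<integral>\<^sup>+x. ennreal (indicator B (Z x) * ?h (Z x)) \<partial>M)"
        by (intro nn_integral_cong) (auto simp: A indicator_def)
      also have "\<dots> = (\<integral>\<^sup>+z. ennreal (?f z) * ennreal (indicator B z * ?h z) \<partial>lborel)"
        by (rule distributed_nn_integral[OF distributed_mixture, symmetric]) simp
      also have "\<dots> = (\<integral>\<^sup>+z. ennreal (\<pi>\<^sub>0 * f\<^sub>0 z) * indicator B z \<partial>lborel)"
        by (intro nn_integral_cong) (simp add: fe indicator_def del: ennreal_plus)
      also have "\<dots> = emeasure M (N \<inter> A)"
        unfolding A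
        by (rule emeasure_joint[symmetric]) (auto simp: prob_null f0_nonneg null_law)
      finally show ?thesis .
    qed
    have "0 \<le> (\<integral>x\<in>A. ?h (Z x) \<partial>M)"
      unfolding set_lebesgue_integral_def using hb by (auto intro!: integral_nonneg_AE)
    then have "(\<integral>x\<in>A. ?h (Z x) \<partial>M) = prob (N \<inter> A)"
      using D by (simp add: emeasure_eq_measure)
    moreover have "(\<integral>x\<in>A. indicator N x \<partial>M) = prob (N \<inter> A)"
      unfolding set_lebesgue_integral_def
      by (simp add: indicator_inter_arith[symmetric] Int_commute)
    ultimately show "(\<integral>x\<in>A. indicator N x \<partial>M) = (\<integral>x\<in>A. ?h (Z x) \<partial>M)" by simp
  next
    show "integrable M (\<lambda>x. ?h (Z x))"
      using hb by (intro integrable_const_bound[where B=1]) auto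
    show "integrable M (indicator N :: 'a \<Rightarrow> real)" by (simp add: emeasure_eq_measure)
    show "(\<lambda>x. ?h (Z x)) \<in> borel_measurable ?S"
      using ZS by (rule measurable_compose) simp
  qed
qed

end

end

theory Submission
  imports Defs
begin

text \<open>Bayes' rule gives \<open>local_fdr\<close> at z as \<pi>0 f0(z) / f(z), which is \<pi>0
  divided by the density ratio f(z) / f0(z). The comparison density at F0(z) is this same ratio
  taken at the quantile of F0(z), so everything rests on that quantile being z itself. This is
  \<open>quantile_cdf\<close>: F0 cannot be flat just to the left of z, because f0 is positive
  wherever F0 lies strictly between 0 and 1 (\<open>has_density_strict_increase\<close>).\<close>

lemma has_density_mono:
  assumes "has_density P p"
  shows "mono P"
proof -
  interpret finite_borel_measure "density lborel (\<lambda>t. ennreal (p t))"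
    using assms
    by (auto simp: has_density_def finite_borel_measure_def finite_borel_measure_axioms_def
        prob_space.finite_measure)
  show ?thesis
    using assms cdf_nondecreasing by (auto simp: has_density_def mono_def)
qed

text \<open>The increment of P is the mass of the half-open interval, and a positive density gives
  positive mass to a set of positive Lebesgue measure.\<close>

lemma has_density_strict_increase:
  assumes P: "has_density P p" and "x < y" and pos: "\<And>t. x < t \<Longrightarrow> t \<le> y \<Longrightarrow> 0 < p t"
  shows "P x < P y"
proof -
  let ?D = "density lborel (\<lambda>t. ennreal (p t))"
  have [measurable]: "p \<in> borel_measurable borel"
    using P by (simp add: has_density_def)
  interpret finite_borel_measure ?D
    using P
    by (auto simp: has_density_def finite_borel_measure_def finite_borel_measure_axioms_def
        prob_space.finite_measure)
  have diff: "P y - P x = measure ?D {x<..y}"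
    using P cdf_diff_eq[OF \<open>x < y\<close>] by (simp add: has_density_def)
  have "measure ?D {x<..y} \<noteq> 0"
  proof
    assume "measure ?D {x<..y} = 0"
    then have "{x<..y} \<in> null_sets ?D"
      by (simp add: emeasure_eq_measure null_sets_def)
    \<comment> \<open>Zero mass forces the density to vanish almost everywhere on the interval; by
      \<open>pos\<close> the interval is then Lebesgue-null, although its length is y - x >
      0.\<close>
    then have "AE t in lborel. t \<in> {x<..y} \<longrightarrow> ennreal (p t) = 0"
      by (subst (asm) null_sets_density_iff) auto
    then have "AE t in lborel. t \<notin> {x<..y}"
      by eventually_elim (use pos in \<open>force simp: ennreal_eq_0_iff\<close>)
    then have "emeasure lborel {x<..y} = 0"
      by (subst (asm) AE_iff_measurable[of "{x<..y}"]) auto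
    then show False
      using \<open>x < y\<close> by simp
  qed
  then show ?thesis
    using diff measure_nonneg[of ?D "{x<..y}"] by linarith
qed

text \<open>The point z belongs to the set whose infimum defines the quantile, so it remains to see
  that no smaller point does.\<close>

lemma quantile_cdf:
  assumes P: "has_density P p" and pos: "\<And>x. 0 < P x \<Longrightarrow> P x < 1 \<Longrightarrow> 0 < p x"
    and z: "0 < P z" "P z < 1"
  shows "quantile P (P z) = z"
  unfolding quantile_def
proof (rule cInf_eq_minimum)
  fix x assume "x \<in> {x. P z \<le> P x}"
  then have le: "P z \<le> P x" by simp
  show "z \<le> x"
  proof (rule ccontr)
    assume "\<not> z \<le> x"
    then have "x < z" by simp
    \<comment> \<open>Monotonicity squeezes P t between P x and P z, and P z \<le> P x, so P t
      equals P z and lies strictly between 0 and 1.\<close>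
    moreover have "0 < p t" if "x < t" "t \<le> z" for t
      using monoD[OF has_density_mono[OF P], of x t] monoD[OF has_density_mono[OF P], of t z]
        that le z by (intro pos) linarith+
    ultimately have "P x < P z"
      using has_density_strict_increase[OF P] by blast
    with le show False by simp
  qed
qed simp

theorem theorem3:
  fixes M :: "'a measure" and N :: "'a set" and Z :: "'a \<Rightarrow> real"
    and \<pi>\<^sub>0 z :: real and F\<^sub>0 f\<^sub>0 G g F f :: "real \<Rightarrow> real"
  assumes "two_groups_model M N Z \<pi>\<^sub>0 F\<^sub>0 f\<^sub>0 G g"
    and "0 < \<pi>\<^sub>0" and "\<pi>\<^sub>0 \<le> 1"
    and "\<And>x. 0 < F\<^sub>0 x \<Longrightarrow> F\<^sub>0 x < 1 \<Longrightarrow> 0 < f\<^sub>0 x"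
    and "F = (\<lambda>x. \<pi>\<^sub>0 * F\<^sub>0 x + (1 - \<pi>\<^sub>0) * G x)"
    and "f = (\<lambda>x. \<pi>\<^sub>0 * f\<^sub>0 x + (1 - \<pi>\<^sub>0) * g x)"
    and "0 < F\<^sub>0 z" and "F\<^sub>0 z < 1"
  shows "local_fdr M N f\<^sub>0 g z = \<pi>\<^sub>0 / comparison_density F\<^sub>0 f\<^sub>0 f (F\<^sub>0 z)"
proof -
  interpret two_groups_model M N Z \<pi>\<^sub>0 F\<^sub>0 f\<^sub>0 G g by fact
  have "quantile F\<^sub>0 (F\<^sub>0 z) = z"
    using density_null assms(4,7,8) by (rule quantile_cdf)
  then show ?thesis
    by (simp add: comparison_density_def local_fdr_def bayes_posterior_def prob_null
        prob_nonnull assms(6))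
qed

end
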